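(* Let $T=z^4+p_2z^2+p_0$ and $Q=z^2+q_1z+q_0$ define the torus $\mathcal{T}$ and the quadric $\mathcal{Q}$ as in the context, and let $\mathcal{C}_{\mathbb{R}}=\mathcal{T}\cap\mathcal{Q}$. Let $(x_0,y_0,0)\in\mathcal{C}_{\mathbb{R}}$. Then the following are equivalent: 1. The point $(x_0,y_0)$ is a non-transversal intersection point of the plane curves defined by $\Delta_{\mathcal{T}}$ and $\Delta_{\mathcal{Q}}$. 2. The Jacobian matrix of $T$ and $Q$ (with respect to $x,y,z$) at $(x_0,y_0,0)$ has rank one.
   Context: Fix real numbers $0<r<R$. Put $p_2(x,y)=2(R^2-r^2+x^2+y^2)$, $p_0(x,y)=(R^2+2Rr+r^2-x^2-y^2)(R^2-2Rr+r^2-x^2-y^2)$, $T=z^4+p_2z^2+p_0\in\mathbb{R}[x,y,z]$, and $\mathcal{T}=\{T=0\}\subset\mathbb{R}^3$ (a ring torus). Let $q_1=ex+fy+i$ and $q_0=ax^2+by^2+dxy+gx+hy+j$ with real coefficients, $Q=z^2+q_1z+q_0$, and $\mathcal{Q}=\{Q=0\}\subset\mathbb{R}^3$. Standing assumption: the quadric is irreducible, i.e. neither the square of a plane nor the union of two planes. $\Delta_{\mathcal{T}}=p_0$ and $\Delta_{\mathcal{Q}}=q_1^2-4q_0$. Two plane algebraic curves intersect transversally at a common point $P$ if $P$ is a regular point of both and their tangent lines at $P$ are different (equivalently, the Jacobian determinant of the defining polynomials with respect to $x,y$ does not vanish at $P$); a common point where this fails is a non-transversal intersection point. *)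

theory Defs
  imports "HOL-Analysis.Analysis" "HOL-Computational_Algebra.Polynomial"
begin

text \<open>
  A polynomial ring in two or three variables is an iterated univariate one:
  \<open>real poly poly\<close> is \<open>(\<real>[x])[y]\<close> and \<open>real poly poly poly\<close> is \<open>((\<real>[x])[y])[z]\<close>.
  The list notation \<open>[:c0, c1, \<dots>:]\<close> at the outermost level of the latter thus lists coefficients
  of \<open>1, z, \<dots>\<close> in \<open>\<real>[x,y]\<close>.
\<close>

definition const_xy :: "real \<Rightarrow> real poly poly"
  where "const_xy c = [:[:c:]:]"

definition var_x :: "real poly poly"
  where "var_x = [:[:0, 1:]:]"

definition var_y :: "real poly poly"
  where "var_y = [:0, 1:]"

definition eval_xy :: "real poly poly \<Rightarrow> real^2 \<Rightarrow> real"
  where "eval_xy p v = poly (poly p [:v$2:]) (v$1)"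

definition eval_xyz :: "real poly poly poly \<Rightarrow> real^3 \<Rightarrow> real"
  where "eval_xyz p v = poly (poly (poly p [:[:v$3:]:]) [:v$2:]) (v$1)"

definition curve :: "real poly poly \<Rightarrow> (real^2) set"
  where "curve p = {v. eval_xy p v = 0}"

definition surface :: "real poly poly poly \<Rightarrow> (real^3) set"
  where "surface p = {v. eval_xyz p v = 0}"

definition torus_p2 :: "real \<Rightarrow> real \<Rightarrow> real poly poly"
  where "torus_p2 R r = const_xy 2 * (const_xy (R^2 - r^2) + var_x^2 + var_y^2)"

definition torus_p0 :: "real \<Rightarrow> real \<Rightarrow> real poly poly"
  where "torus_p0 R r =
    (const_xy (R^2 + 2*R*r + r^2) - var_x^2 - var_y^2) *
    (const_xy (R^2 - 2*R*r + r^2) - var_x^2 - var_y^2)"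

definition torus_poly :: "real \<Rightarrow> real \<Rightarrow> real poly poly poly"
  where "torus_poly R r = [:torus_p0 R r, 0, torus_p2 R r, 0, 1:]"

definition quadric_q1 :: "real \<Rightarrow> real \<Rightarrow> real \<Rightarrow> real poly poly"
  where "quadric_q1 e f i = const_xy e * var_x + const_xy f * var_y + const_xy i"

definition quadric_q0 ::
    "real \<Rightarrow> real \<Rightarrow> real \<Rightarrow> real \<Rightarrow> real \<Rightarrow> real \<Rightarrow> real poly poly"
  where "quadric_q0 a b d g h j =
    const_xy a * var_x^2 + const_xy b * var_y^2 + const_xy d * var_x * var_y
    + const_xy g * var_x + const_xy h * var_y + const_xy j"

definition quadric_poly :: "real poly poly \<Rightarrow> real poly poly \<Rightarrow> real poly poly poly"
  where "quadric_poly q1 q0 = [:q0, q1, 1:]"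

definition Delta_torus :: "real \<Rightarrow> real \<Rightarrow> real poly poly"
  where "Delta_torus R r = torus_p0 R r"

definition Delta_quadric :: "real poly poly \<Rightarrow> real poly poly \<Rightarrow> real poly poly"
  where "Delta_quadric q1 q0 = q1^2 - 4 * q0"

text \<open>
  Regularity and the tangent line refer to the differential of the defining polynomial itself,
  not of its squarefree part.
\<close>

definition regular_point :: "real poly poly \<Rightarrow> real^2 \<Rightarrow> bool"
  where "regular_point p P \<longleftrightarrow>
    P \<in> curve p \<and> frechet_derivative (eval_xy p) (at P) \<noteq> (\<lambda>v. 0)"

definition tangent_line :: "real poly poly \<Rightarrow> real^2 \<Rightarrow> (real^2) set"
  where "tangent_line p P = {w. frechet_derivative (eval_xy p) (at P) (w - P) = 0}"

definition transversal_at :: "real poly poly \<Rightarrow> real poly poly \<Rightarrow> real^2 \<Rightarrow> bool"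
  where "transversal_at p q P \<longleftrightarrow>
    regular_point p P \<and> regular_point q P \<and> tangent_line p P \<noteq> tangent_line q P"

definition non_transversal_intersection_point ::
    "real poly poly \<Rightarrow> real poly poly \<Rightarrow> real^2 \<Rightarrow> bool"
  where "non_transversal_intersection_point p q P \<longleftrightarrow>
    P \<in> curve p \<inter> curve q \<and> \<not> transversal_at p q P"

definition jacobian_matrix ::
    "real poly poly poly \<Rightarrow> real poly poly poly \<Rightarrow> real^3 \<Rightarrow> real^3^2"
  where "jacobian_matrix p q P =
    jacobian (\<lambda>v. vector [eval_xyz p v, eval_xyz q v] :: real^2) (at P)"

end

theory Submission
  imports Defs
begin

text \<open>
  Write \<open>P = (x0, y0)\<close>. Along \<open>z = 0\<close> a polynomial \<open>c0 + c1 z + \<dots>\<close> has gradient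
  \<open>(\<nabla>c0, c1)\<close>, so the rows of the Jacobian matrix at \<open>(x0, y0, 0)\<close> are \<open>(\<nabla>p0(P), 0)\<close> and
  \<open>(\<nabla>q0(P), q1(P))\<close>. On the curve \<open>p0 = 0\<close>, which consists of two concentric circles of distinct
  positive radii, \<open>\<nabla>p0\<close> does not vanish. Hence the rank is one exactly when the second row is a
  multiple of the first, that is, when \<open>q1(P) = 0\<close> and \<open>\<nabla>q0(P)\<close> is a multiple of \<open>\<nabla>p0(P)\<close>.

  On the planar side \<open>q0(P) = 0\<close>, so \<open>q1\<^sup>2 - 4 q0\<close> vanishes at \<open>P\<close> exactly when \<open>q1(P) = 0\<close>, and
  its gradient there is then \<open>-4 \<nabla>q0(P)\<close>. Since \<open>\<nabla>p0(P) \<noteq> 0\<close>, transversality fails exactly when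
  this gradient is a multiple of \<open>\<nabla>p0(P)\<close>, the zero vector included. Both conditions
  are therefore the same. The two halves are \<open>rank_jacobian_eq_1_iff\<close> and
  \<open>not_transversal_iff_gradient_in_span\<close>.
\<close>

section \<open>Evaluation and gradients of polynomial functions\<close>

lemma eval_xy_simps [simp]:
  "eval_xy (p + q) v = eval_xy p v + eval_xy q v"
  "eval_xy (p - q) v = eval_xy p v - eval_xy q v"
  "eval_xy (p * q) v = eval_xy p v * eval_xy q v"
  "eval_xy (p ^ n) v = eval_xy p v ^ n"
  "eval_xy 0 v = 0"
  "eval_xy 1 v = 1"
  "eval_xy (numeral k) v = numeral k"
  "eval_xy (const_xy s) v = s"
  "eval_xy var_x v = v $ 1"
  "eval_xy var_y v = v $ 2"
  by (simp_all add: eval_xy_def const_xy_def var_x_def var_y_def)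

lemma eval_xy_pCons: "eval_xy (pCons c p) v = poly c (v $ 1) + v $ 2 * eval_xy p v"
  by (simp add: eval_xy_def)

lemma eval_xyz_pCons:
  "eval_xyz (pCons c p) v = eval_xy c (vector [v $ 1, v $ 2]) + v $ 3 * eval_xyz p v"
  by (simp add: eval_xyz_def eval_xy_def)

lemma bounded_linear_drop_z: "bounded_linear (\<lambda>v::real^3. vector [v $ 1, v $ 2] :: real^2)"
  by (intro linear_conv_bounded_linear[THEN iffD1] linearI)
     (simp_all add: vec_eq_iff forall_2)

lemma poly_differentiable_compose:
  fixes f :: "'a::real_normed_vector \<Rightarrow> real"
  assumes "f differentiable at P"
  shows "(\<lambda>v. poly c (f v)) differentiable at P"
proof -
  have "poly c differentiable at (f P)"
    unfolding real_differentiable_def using poly_DERIV by (rule exI)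
  then show ?thesis
    using assms differentiable_chain_at[of f P "poly c"] by (simp add: o_def)
qed

lemma eval_xy_differentiable: "eval_xy p differentiable at P"
proof (induction p)
  case 0
  then show ?case by (simp add: eval_xy_def[abs_def])
next
  case (pCons c p)
  have nth: "(\<lambda>v::real^2. v $ k) differentiable at P" for k
    by (intro bounded_linear_imp_differentiable bounded_linear_vec_nth)
  show ?case
    unfolding eval_xy_pCons[abs_def]
    by (rule differentiable_add[OF poly_differentiable_compose[OF nth]
          differentiable_mult[OF nth pCons.IH]])
qed

lemma eval_xyz_differentiable: "eval_xyz p differentiable at P"
proof (induction p)
  case 0
  then show ?case by (simp add: eval_xyz_def[abs_def])
next
  case (pCons c p)
  have nth: "(\<lambda>v::real^3. v $ k) differentiable at P" for k
    by (intro bounded_linear_imp_differentiable bounded_linear_vec_nth)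
  have "(\<lambda>v::real^3. eval_xy c (vector [v $ 1, v $ 2])) differentiable at P"
    using differentiable_chain_at[OF bounded_linear_imp_differentiable[OF bounded_linear_drop_z]
        eval_xy_differentiable]
    by (simp add: o_def)
  then show ?case
    unfolding eval_xyz_pCons[abs_def]
    by (rule differentiable_add[OF _ differentiable_mult[OF nth pCons.IH]])
qed

lemma eval_xy_has_gradient:
  obtains u where "(eval_xy p has_derivative (\<lambda>w. u \<bullet> w)) (at P)"
proof -
  obtain D where D: "(eval_xy p has_derivative D) (at P)"
    using eval_xy_differentiable by (auto simp: differentiable_def)
  then have "linear D"
    by (rule has_derivative_linear)
  \<comment> \<open>The adjoint of a linear functional, applied to 1, is the vector that represents it.\<close>
  then have "D = (\<lambda>w. adjoint D 1 \<bullet> w)"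
    using adjoint_works[of D _ 1] by (auto simp: inner_commute)
  with D that show ?thesis by metis
qed

text \<open>
  Where \<open>z = 0\<close>, the product rule kills every contribution of the terms of order at least two
  in \<open>z\<close>; \<open>eval_xyz p P\<close> is then the coefficient of \<open>z\<close> in \<open>pCons c p\<close>, evaluated at
  the point below \<open>P\<close>.
\<close>

lemma eval_xyz_pCons_gradient:
  fixes P :: "real^3" and u :: "real^2"
  assumes "P $ 3 = 0"
    and u: "(eval_xy c has_derivative (\<lambda>w. u \<bullet> w)) (at (vector [P $ 1, P $ 2]))"
  shows "(eval_xyz (pCons c p) has_derivative
           (\<lambda>w. (vector [u $ 1, u $ 2, eval_xyz p P] :: real^3) \<bullet> w)) (at P)"
proof -
  obtain D where D: "(eval_xyz p has_derivative D) (at P)"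
    using eval_xyz_differentiable by (auto simp: differentiable_def)
  have "((\<lambda>v::real^3. eval_xy c (vector [v $ 1, v $ 2])) has_derivative
          (\<lambda>w. u \<bullet> vector [w $ 1, w $ 2])) (at P)"
    using has_derivative_compose[OF bounded_linear_imp_has_derivative[OF bounded_linear_drop_z] u]
    by simp
  moreover have "((\<lambda>v::real^3. v $ 3) has_derivative (\<lambda>w. w $ 3)) (at P)"
    by (intro bounded_linear_imp_has_derivative bounded_linear_vec_nth)
  ultimately show ?thesis
    unfolding eval_xyz_pCons[abs_def]
    by (auto intro!: derivative_eq_intros D simp: assms(1) inner_vec_def sum_2 sum_3)
qed

section \<open>Transversality and rank in terms of gradients\<close>

text \<open>
  The component of \<open>v\<close> orthogonal to \<open>u\<close> lies in the kernel of \<open>u\<close>; if that kernel is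
  contained in the kernel of \<open>v\<close>, the component is orthogonal to itself.
\<close>

lemma in_span_singleton_if_kernel_subset:
  fixes u v :: "'a::real_inner"
  assumes "\<And>w. u \<bullet> w = 0 \<Longrightarrow> v \<bullet> w = 0"
  shows "v \<in> span {u}"
proof (cases "u = 0")
  case True
  then have "v \<bullet> v = 0" using assms by simp
  then show ?thesis by (simp add: span_zero)
next
  case False
  define w where "w = v - (u \<bullet> v / (u \<bullet> u)) *\<^sub>R u"
  have uw: "u \<bullet> w = 0"
    using False by (simp add: w_def inner_diff_right)
  moreover have "w \<bullet> w = v \<bullet> w - (u \<bullet> v / (u \<bullet> u)) * (u \<bullet> w)"
    by (subst w_def) (simp add: inner_diff_left)
  ultimately have "w = 0"
    using assms by simp
  then show ?thesis
    by (auto simp: w_def span_singleton)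
qed

text \<open>
  At a common point at which the first curve is regular, singularity of the second curve
  (\<open>v = 0\<close>) and tangency both say that \<open>v\<close> is a multiple of \<open>u\<close>.
\<close>

lemma not_transversal_iff_gradient_in_span:
  assumes u: "(eval_xy p has_derivative (\<lambda>w. u \<bullet> w)) (at P)" "u \<noteq> 0"
    and v: "(eval_xy q has_derivative (\<lambda>w. v \<bullet> w)) (at P)"
    and P: "P \<in> curve p" "P \<in> curve q"
  shows "\<not> transversal_at p q P \<longleftrightarrow> v \<in> span {u}"
proof -
  have fd: "frechet_derivative (eval_xy p) (at P) = (\<lambda>w. u \<bullet> w)"
    "frechet_derivative (eval_xy q) (at P) = (\<lambda>w. v \<bullet> w)"
    using frechet_derivative_at[OF u(1)] frechet_derivative_at[OF v] by simp_all
  have functional_nz: "(\<lambda>w. x \<bullet> w) \<noteq> (\<lambda>w. 0) \<longleftrightarrow> x \<noteq> 0" for x :: "real^2"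
    by (metis inner_eq_zero_iff inner_zero_left)
  have line: "tangent_line p P = tangent_line q P \<longleftrightarrow> (\<forall>w. u \<bullet> w = 0 \<longleftrightarrow> v \<bullet> w = 0)"
  proof
    assume eq: "tangent_line p P = tangent_line q P"
    show "\<forall>w. u \<bullet> w = 0 \<longleftrightarrow> v \<bullet> w = 0"
    proof
      fix w
      have "P + w \<in> tangent_line p P \<longleftrightarrow> P + w \<in> tangent_line q P"
        using eq by simp
      then show "u \<bullet> w = 0 \<longleftrightarrow> v \<bullet> w = 0"
        by (simp add: tangent_line_def fd)
    qed
  qed (simp add: tangent_line_def fd)
  have "v = 0 \<or> (\<forall>w. u \<bullet> w = 0 \<longleftrightarrow> v \<bullet> w = 0) \<longleftrightarrow> v \<in> span {u}"
    using in_span_singleton_if_kernel_subset[of u v] by (auto simp: span_singleton)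
  then show ?thesis
    using u(2) P by (auto simp: transversal_at_def regular_point_def fd functional_nz line)
qed

text \<open>
  The gradients are the rows of the Jacobian matrix. The nonzero row \<open>s\<close> alone gives rank one, and
  \<open>t\<close> raises the rank exactly when it lies outside the line spanned by \<open>s\<close>.
\<close>

lemma rank_jacobian_eq_1_iff:
  assumes s: "(eval_xyz p has_derivative (\<lambda>w. s \<bullet> w)) (at P)" "s \<noteq> 0"
    and t: "(eval_xyz q has_derivative (\<lambda>w. t \<bullet> w)) (at P)"
  shows "rank (jacobian_matrix p q P) = 1 \<longleftrightarrow> t \<in> span {s}"
proof -
  have "((\<lambda>v. vector [eval_xyz p v, eval_xyz q v] :: real^2) has_derivative
          (\<lambda>w. vector [s \<bullet> w, t \<bullet> w])) (at P)"
    unfolding has_derivative_componentwise_within[where 'b = "real^2"]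
    using s(1) t by (auto simp: Basis_vec_def inner_axis exhaust_2 UNIV_2)
  then have "jacobian_matrix p q P = matrix (\<lambda>w. vector [s \<bullet> w, t \<bullet> w])"
    unfolding jacobian_matrix_def jacobian_def by (simp flip: frechet_derivative_at)
  then have "row 1 (jacobian_matrix p q P) = s" "row 2 (jacobian_matrix p q P) = t"
    by (simp_all add: row_def matrix_def vec_eq_iff inner_axis)
  then have "rows (jacobian_matrix p q P) = {t, s}"
    by (auto simp: rows_def UNIV_2)
  then have "rank (jacobian_matrix p q P) = dim {t, s}"
    by (simp add: row_rank_def)
  then show ?thesis
    using s(2) by (simp add: dim_insert)
qed

section \<open>The discriminants of the torus and the quadric\<close>

text \<open>
  Both circle factors have gradient \<open>-2 P\<close>, so \<open>\<nabla>p0 = -2 (A + B) P\<close> for the factors \<open>A\<close> and \<open>B\<close>.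
  On the curve one factor vanishes; the other does not, because \<open>A - B = 4 R r\<close>. The
  center \<open>P = 0\<close> is not on the curve, because both radii are positive.
\<close>

lemma torus_p0_gradient_nonzero:
  fixes R r :: real
  assumes "0 < r" "r < R" "eval_xy (torus_p0 R r) P = 0"
    and u: "(eval_xy (torus_p0 R r) has_derivative (\<lambda>w. u \<bullet> w)) (at P)"
  shows "u \<noteq> 0"
proof
  assume "u = 0"
  define A B where "A = (R^2 + 2*R*r + r^2) - (P $ 1)^2 - (P $ 2)^2"
    and "B = (R^2 - 2*R*r + r^2) - (P $ 1)^2 - (P $ 2)^2"
  have nth: "((\<lambda>v::real^2. v $ k) has_derivative (\<lambda>w. w $ k)) (at P)" for k
    by (intro bounded_linear_imp_has_derivative bounded_linear_vec_nth)
  have "(eval_xy (torus_p0 R r) has_derivative (\<lambda>w. -2 * (A + B) * (P \<bullet> w))) (at P)"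
    unfolding torus_p0_def eval_xy_simps[abs_def]
    by (auto intro!: derivative_eq_intros nth
        simp: A_def B_def inner_vec_def sum_2 algebra_simps power2_eq_square power3_eq_cube)
  then have "(\<lambda>w. u \<bullet> w) = (\<lambda>w. -2 * (A + B) * (P \<bullet> w))"
    using u has_derivative_unique by blast
  then have "(A + B) * (P \<bullet> P) = 0"
    using \<open>u = 0\<close> by (auto dest: fun_cong[where x = P])
  moreover have AB: "A * B = 0"
    using assms(3) by (simp add: torus_p0_def A_def B_def)
  moreover have "A + B \<noteq> 0"
  proof
    assume "A + B = 0"
    with AB have "A = 0" "B = 0"
      by (auto simp: add_eq_0_iff)
    moreover have "A - B = 4 * (R * r)"
      by (simp add: A_def B_def)
    ultimately show False
      using assms(1,2) by simp
  qed
  ultimately have "P = 0"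
    by simp
  then have "A = (R + r)^2" "B = (R - r)^2"
    by (simp_all add: A_def B_def power2_sum power2_diff)
  then show False
    using AB assms(1,2) by simp
qed

text \<open>The square \<open>q1\<^sup>2\<close> vanishes to second order where \<open>q1\<close> does.\<close>

lemma Delta_quadric_gradient:
  assumes "eval_xy q1 P = 0" and v: "(eval_xy q0 has_derivative (\<lambda>w. v \<bullet> w)) (at P)"
  shows "(eval_xy (Delta_quadric q1 q0) has_derivative (\<lambda>w. (-4 *\<^sub>R v) \<bullet> w)) (at P)"
proof -
  obtain D where "(eval_xy q1 has_derivative D) (at P)"
    using eval_xy_differentiable by (auto simp: differentiable_def)
  then show ?thesis
    unfolding Delta_quadric_def eval_xy_simps[abs_def]
    by (auto intro!: derivative_eq_intros v simp: assms(1))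
qed

theorem theorem3p14:
  fixes R r a b d e f g h i j x0 y0 :: real
    and q1 q0 :: "real poly poly"
    and T Q :: "real poly poly poly"
  assumes "0 < r" and "r < R"
    and "T = torus_poly R r"
    and "q1 = quadric_q1 e f i"
    and "q0 = quadric_q0 a b d g h j"
    and "Q = quadric_poly q1 q0"
    and "irreducible Q"
    and "vector [x0, y0, 0] \<in> surface T \<inter> surface Q"
  shows "non_transversal_intersection_point (Delta_torus R r) (Delta_quadric q1 q0) (vector [x0, y0])
    \<longleftrightarrow> rank (jacobian_matrix T Q (vector [x0, y0, 0])) = 1"
proof -
  define P :: "real^2" where "P = vector [x0, y0]"
  define P3 :: "real^3" where "P3 = vector [x0, y0, 0]"
  have P3: "P3 $ 3 = 0" "vector [P3 $ 1, P3 $ 2] = P"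
    by (simp_all add: P_def P3_def)
  have zero: "eval_xy (torus_p0 R r) P = 0" "eval_xy q0 P = 0"
    using assms(8)
    by (simp_all add: surface_def assms(3,6) torus_poly_def quadric_poly_def eval_xyz_pCons P_def)
  obtain u where u: "(eval_xy (torus_p0 R r) has_derivative (\<lambda>w. u \<bullet> w)) (at P)"
    by (rule eval_xy_has_gradient)
  obtain v where v: "(eval_xy q0 has_derivative (\<lambda>w. v \<bullet> w)) (at P)"
    by (rule eval_xy_has_gradient)
  have u_nz: "u \<noteq> 0"
    using torus_p0_gradient_nonzero[OF assms(1,2) zero(1) u] .

  have "(eval_xyz T has_derivative (\<lambda>w. (vector [u $ 1, u $ 2, 0] :: real^3) \<bullet> w)) (at P3)"
    using eval_xyz_pCons_gradient[of P3 "torus_p0 R r" u "[:0, torus_p2 R r, 0, 1:]"] u P3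
    by (simp add: assms(3) torus_poly_def eval_xyz_pCons)
  moreover have "(vector [u $ 1, u $ 2, 0] :: real^3) \<noteq> 0"
    using u_nz by (auto simp: vec_eq_iff forall_2 forall_3)
  moreover have "(eval_xyz Q has_derivative
      (\<lambda>w. (vector [v $ 1, v $ 2, eval_xy q1 P] :: real^3) \<bullet> w)) (at P3)"
    using eval_xyz_pCons_gradient[of P3 q0 v "[:q1, 1:]"] v P3
    by (simp add: assms(6) quadric_poly_def eval_xyz_pCons)
  ultimately have "rank (jacobian_matrix T Q P3) = 1 \<longleftrightarrow>
      (vector [v $ 1, v $ 2, eval_xy q1 P] :: real^3) \<in> span {vector [u $ 1, u $ 2, 0]}"
    by (rule rank_jacobian_eq_1_iff)
  also have "\<dots> \<longleftrightarrow> eval_xy q1 P = 0 \<and> v \<in> span {u}"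
    by (auto simp: span_singleton vec_eq_iff forall_2 forall_3)
  also have "\<dots> \<longleftrightarrow>
      non_transversal_intersection_point (Delta_torus R r) (Delta_quadric q1 q0) P"
  proof (cases "eval_xy q1 P = 0")
    case True
    have "P \<in> curve (Delta_torus R r)" "P \<in> curve (Delta_quadric q1 q0)"
      using zero True by (simp_all add: curve_def Delta_torus_def Delta_quadric_def)
    then have "non_transversal_intersection_point (Delta_torus R r) (Delta_quadric q1 q0) P \<longleftrightarrow>
        -4 *\<^sub>R v \<in> span {u}"
      using not_transversal_iff_gradient_in_span[OF _ u_nz Delta_quadric_gradient[OF True v]] u
      by (simp add: non_transversal_intersection_point_def Delta_torus_def)
    also have "\<dots> \<longleftrightarrow> v \<in> span {u}"
      using span_mul[of "-4 *\<^sub>R v" "{u}" "-1/4"] span_mul[of v "{u}" "-4"] by auto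
    finally show ?thesis
      using True by simp
  next
    case False
    then have "P \<notin> curve (Delta_quadric q1 q0)"
      using zero by (simp add: curve_def Delta_quadric_def)
    then show ?thesis
      using False by (simp add: non_transversal_intersection_point_def)
  qed
  finally show ?thesis
    by (simp add: P_def P3_def)
qed

end
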